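(* Let $\ell_1,\ell_2,\ell_3$ be positive integers and let $(C_3,L)$ be the corresponding edge-labeled triangle. Let $\mathcal{G}_0=(1,1,1)$, let $\mathcal{G}_1=(0,g_2,g_3)$ be a smallest flow-up class $\mathcal{G}_1$ on $(C_3,L)$, and let $\mathcal{G}_2=(0,0,\operatorname{lcm}(\ell_2,\ell_3))$. Then $\{\mathcal{G}_0,\mathcal{G}_1,\mathcal{G}_2\}$ is a basis over $\mathbb{Z}$ of the $\mathbb{Z}$-module of generalized splines on $(C_3,L)$.
   Context: The edge-labeled triangle $(C_3,L)$ has vertices $v_1,v_2,v_3$, edge $v_1v_2$ labeled $\ell_1$, edge $v_2v_3$ labeled $\ell_2$, edge $v_3v_1$ labeled $\ell_3$. A generalized spline on $(C_3,L)$ is a triple $(g_1,g_2,g_3)\in\mathbb{Z}^3$ with $g_1\equiv g_2\pmod{\ell_1}$, $g_2\equiv g_3\pmod{\ell_2}$, $g_3\equiv g_1\pmod{\ell_3}$; these form a $\mathbb{Z}$-module under componentwise operations. A flow-up class $\mathcal{G}_1$ is a generalized spline $(0,g_2,g_3)$ with $g_2\ne 0$. A smallest flow-up class $\mathcal{G}_1=(0,g_2,g_3)$ is a flow-up class whose nonzero entries are positive and such that for every flow-up class $(0,g_2',g_3')$ with positive entries one has $g_2'\ge g_2$ and $g_3'\ge g_3$. *)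

theory Defs
  imports Complex_Main "HOL-Library.Product_Plus" "HOL-Number_Theory.Cong"
begin

definition zscale :: "int \<Rightarrow> int \<times> int \<times> int \<Rightarrow> int \<times> int \<times> int" where
  "zscale c v = (case v of (x, y, z) \<Rightarrow> (c * x, c * y, c * z))"

global_interpretation int3: module zscale
  by standard (auto simp: zscale_def algebra_simps)

text \<open>The edges \<open>v\<^sub>1v\<^sub>2\<close>, \<open>v\<^sub>2v\<^sub>3\<close>, \<open>v\<^sub>3v\<^sub>1\<close> carry the labels \<open>l1\<close>, \<open>l2\<close>, \<open>l3\<close>.\<close>

definition triangle_splines :: "int \<Rightarrow> int \<Rightarrow> int \<Rightarrow> (int \<times> int \<times> int) set" where
  "triangle_splines l1 l2 l3 =
     {(g1, g2, g3). [g1 = g2] (mod l1) \<and> [g2 = g3] (mod l2) \<and> [g3 = g1] (mod l3)}"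

lemma subspace_triangle_splines: "int3.subspace (triangle_splines l1 l2 l3)"
  by (rule int3.subspaceI)
    (auto simp: triangle_splines_def zscale_def zero_prod_def
      intro: cong_add cong_scalar_left)

definition flow_up_class1 :: "int \<Rightarrow> int \<Rightarrow> int \<Rightarrow> int \<times> int \<times> int \<Rightarrow> bool" where
  "flow_up_class1 l1 l2 l3 g \<longleftrightarrow>
     g \<in> triangle_splines l1 l2 l3 \<and> (\<exists>g2 g3. g = (0, g2, g3) \<and> g2 \<noteq> 0)"

text \<open>Only the nonzero entries of the class itself have to be positive, so \<open>g3 = 0\<close> is allowed.
  The classes it is compared with have both \<open>g2'\<close> and \<open>g3'\<close> positive.\<close>

definition smallest_flow_up_class1 :: "int \<Rightarrow> int \<Rightarrow> int \<Rightarrow> int \<times> int \<times> int \<Rightarrow> bool" where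
  "smallest_flow_up_class1 l1 l2 l3 g \<longleftrightarrow>
     flow_up_class1 l1 l2 l3 g \<and>
     (\<exists>g2 g3. g = (0, g2, g3) \<and> (g2 \<noteq> 0 \<longrightarrow> g2 > 0) \<and> (g3 \<noteq> 0 \<longrightarrow> g3 > 0) \<and>
       (\<forall>g2' g3'. flow_up_class1 l1 l2 l3 (0, g2', g3') \<and> g2' > 0 \<and> g3' > 0
          \<longrightarrow> g2' \<ge> g2 \<and> g3' \<ge> g3))"

definition is_int_basis :: "(int \<times> int \<times> int) set \<Rightarrow> (int \<times> int \<times> int) set \<Rightarrow> bool" where
  "is_int_basis B M \<longleftrightarrow> B \<subseteq> M \<and> int3.independent B \<and> int3.span B = M"

end

theory Submission
  imports Defs
begin

text \<open>If \<open>(0, h2, h3)\<close> is a spline, so is \<open>(0, h2 mod g2, s)\<close> for some \<open>s\<close>, and adding a multiple of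
  \<open>(0, 0, lcm l2 l3)\<close> makes \<open>s\<close> positive; minimality of \<open>g2\<close> therefore forces \<open>g2 dvd h2\<close>.
  Subtracting multiples of the first two generators from a spline thus leaves a spline
  \<open>(0, 0, s)\<close>, where \<open>s\<close> is divisible by \<open>lcm l2 l3\<close>. Independence holds because the generators
  are triangular with nonzero diagonal.\<close>

lemma zscale_triple [simp]: "zscale c (x, y, z) = (c * x, c * y, c * z)"
  by (simp add: zscale_def)

lemma zero_triple: "(0 :: int \<times> int \<times> int) = (0, 0, 0)"
  by (simp add: zero_prod_def)

lemma triangle_splines_iff:
  "(a, b, c) \<in> triangle_splines l1 l2 l3 \<longleftrightarrow> l1 dvd a - b \<and> l2 dvd b - c \<and> l3 dvd c - a"
  by (simp add: triangle_splines_def cong_iff_dvd_diff)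

lemma one_in_triangle_splines: "(1, 1, 1) \<in> triangle_splines l1 l2 l3"
  by (simp add: triangle_splines_iff)

text \<open>The first edge imposes nothing here, and the other two edges ask for a common multiple
  of \<open>l2\<close> and \<open>l3\<close>. This is why the last generator carries the
  lcm.\<close>

lemma triangle_splines_00_iff:
  "(0, 0, s) \<in> triangle_splines l1 l2 l3 \<longleftrightarrow> lcm l2 l3 dvd s"
  by (simp add: triangle_splines_iff lcm_least_iff)

lemma triangle_splines_combination:
  assumes "(a, b, c) \<in> triangle_splines l1 l2 l3" and "(a', b', c') \<in> triangle_splines l1 l2 l3"
  shows "(a + k * a', b + k * b', c + k * c') \<in> triangle_splines l1 l2 l3"
  using int3.subspace_add[OF subspace_triangle_splines assms(1)
      int3.subspace_scale[OF subspace_triangle_splines assms(2), of k]]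
  by simp

text \<open>The factor \<open>1 + \<bar>s\<bar>\<close> exceeds \<open>- s\<close> already when
  \<open>m = 1\<close>, and a larger \<open>m\<close> only helps.\<close>

lemma int_add_multiple_pos:
  fixes m s :: int
  assumes "m > 0"
  shows "s + (1 + \<bar>s\<bar>) * m > 0"
proof -
  have "- s < (1 + \<bar>s\<bar>) * 1" by simp
  also have "\<dots> \<le> (1 + \<bar>s\<bar>) * m"
    using assms by (intro mult_left_mono) auto
  finally show ?thesis by (metis add.commute add.right_inverse add_less_cancel_right)
qed

lemma smallest_flow_up_class1_dvd:
  assumes "l2 > 0" and "l3 > 0"
    and smallest: "smallest_flow_up_class1 l1 l2 l3 (0, g2, g3)"
    and spline: "(0, h2, h3) \<in> triangle_splines l1 l2 l3"
  shows "g2 dvd h2"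
proof (rule ccontr)
  assume ndvd: "\<not> g2 dvd h2"
  have g: "(0, g2, g3) \<in> triangle_splines l1 l2 l3" and "g2 > 0"
    and min: "flow_up_class1 l1 l2 l3 (0, r, t) \<Longrightarrow> r > 0 \<Longrightarrow> t > 0 \<Longrightarrow> g2 \<le> r" for r t
    using smallest by (auto simp: smallest_flow_up_class1_def flow_up_class1_def)
  define s where "s = h3 + (- (h2 div g2)) * g3"
  \<comment> \<open>\<open>s\<close> may be zero or negative, while minimality compares only with
    classes whose last entry is positive as well.\<close>
  define t where "t = s + (1 + \<bar>s\<bar>) * lcm l2 l3"
  have r: "h2 + (- (h2 div g2)) * g2 = h2 mod g2"
    by (simp add: minus_div_mult_eq_mod)
  have "(0, h2 mod g2, s) \<in> triangle_splines l1 l2 l3"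
    using triangle_splines_combination[OF spline g, of "- (h2 div g2)"] unfolding r s_def by simp
  moreover have "(0, 0, lcm l2 l3) \<in> triangle_splines l1 l2 l3"
    by (simp add: triangle_splines_00_iff)
  ultimately have "(0, h2 mod g2, t) \<in> triangle_splines l1 l2 l3"
    using triangle_splines_combination[of 0 "h2 mod g2" s l1 l2 l3 0 0 "lcm l2 l3" "1 + \<bar>s\<bar>"]
    by (simp add: t_def)
  moreover have "h2 mod g2 > 0"
    using ndvd \<open>g2 > 0\<close> by (simp add: dvd_eq_mod_eq_0 order_less_le)
  moreover have "t > 0"
    unfolding t_def using assms(1,2) by (intro int_add_multiple_pos lcm_pos_int) auto
  ultimately have "g2 \<le> h2 mod g2"
    by (intro min[of _ t]) (auto simp: flow_up_class1_def)
  with \<open>g2 > 0\<close> show False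
    using pos_mod_bound[of g2 h2] by linarith
qed

lemma independent_triangular:
  assumes "a \<noteq> 0" and "b \<noteq> 0"
  shows "int3.independent {(1, 1, 1), (0, a, c), (0, 0, b)}"
proof -
  have "f x = 0"
    if eq: "(\<Sum>x\<in>{(1, 1, 1), (0, a, c), (0, 0, b)}. zscale (f x) x) = 0"
    and x: "x \<in> {(1, 1, 1), (0, a, c), (0, 0, b)}"
    for f :: "int \<times> int \<times> int \<Rightarrow> int" and x
  proof -
    \<comment> \<open>The first entry separates \<open>(1, 1, 1)\<close> from the others and
      \<open>a \<noteq> 0\<close> separates those two, so the sum has three terms. Its entries, read
      from first to last, kill the coefficients one at a time.\<close>
    have "f (1, 1, 1) = 0 \<and> f (0, a, c) = 0 \<and> f (0, 0, b) = 0"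
      using eq assms by (auto simp: zero_triple)
    with x show ?thesis by auto
  qed
  then show ?thesis
    by (subst int3.dependent_finite) blast+
qed

text \<open>Reduces membership in the span to exhibiting three coefficients, by peeling off one
  generator at a time.\<close>

lemma span_triple:
  "int3.span {u, v, w} = {zscale i u + zscale j v + zscale k w | i j k. True}"
  by (auto simp: int3.span_insert int3.span_singleton algebra_simps)

theorem theorem3p4:
  fixes l1 l2 l3 g2 g3 :: int
  assumes "l1 > 0" and "l2 > 0" and "l3 > 0"
    and "smallest_flow_up_class1 l1 l2 l3 (0, g2, g3)"
  shows "is_int_basis {(1, 1, 1), (0, g2, g3), (0, 0, lcm l2 l3)} (triangle_splines l1 l2 l3)"
proof -
  let ?S = "triangle_splines l1 l2 l3"
  let ?B = "{(1, 1, 1), (0, g2, g3), (0, 0, lcm l2 l3)}"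
  have g: "(0, g2, g3) \<in> ?S" and "g2 \<noteq> 0"
    using assms(4) by (auto simp: smallest_flow_up_class1_def flow_up_class1_def)
  have sub: "?B \<subseteq> ?S"
    using g by (simp add: one_in_triangle_splines triangle_splines_00_iff)
  have "?S \<subseteq> int3.span ?B"
  proof
    fix x assume "x \<in> ?S"
    moreover obtain a b c where x: "x = (a, b, c)" by (cases x)
    ultimately have "(0, b - a, c - a) \<in> ?S"
      using triangle_splines_combination[OF _ one_in_triangle_splines, of a b c l1 l2 l3 "- a"]
      by simp
    \<comment> \<open>The divisibility lemma allows a zero second entry, so \<open>b = a\<close> is
      covered too.\<close>
    moreover from this obtain j where j: "b - a = g2 * j"
      using smallest_flow_up_class1_dvd[OF assms(2-4)] unfolding dvd_def by blast
    ultimately have "(0, 0, c - a - j * g3) \<in> ?S"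
      using triangle_splines_combination[OF _ g, of 0 "b - a" "c - a" "- j"]
      by (simp add: mult.commute)
    then obtain k where k: "c - a - j * g3 = lcm l2 l3 * k"
      unfolding triangle_splines_00_iff by (rule dvdE)
    have "x = zscale a (1, 1, 1) + zscale j (0, g2, g3) + zscale k (0, 0, lcm l2 l3)"
      using j k by (simp add: x algebra_simps)
    then show "x \<in> int3.span ?B"
      unfolding span_triple by blast
  qed
  moreover have "int3.span ?B \<subseteq> ?S"
    using sub by (rule int3.span_minimal) (rule subspace_triangle_splines)
  moreover have "int3.independent ?B"
    using \<open>g2 \<noteq> 0\<close> assms(2,3) by (intro independent_triangular) auto
  ultimately show ?thesis
    using sub by (simp add: is_int_basis_def)
qed

end
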